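(* Let $q\ge 2$ be an integer, let $Y\in\mathcal S^q$ be irreducible with $|Y|>1$, and let $s\ge 1$ be an integer. Then $S_{*^sY}=*^sS_Y$; that is, if $*^sY=Y_1\times\cdots\times Y_s$ with the $Y_i$ equivalent to $Y$ and of pairwise disjoint supports, then $S_{*^sY}=S_{Y_1}\times\cdots\times S_{Y_s}$.
   Context: Let $\mathrm{Sym}_f(\mathbb N)$ be the group of finitary permutations of $\mathbb N$; for $X\subset \mathrm{Sym}_f(\mathbb N)$ let $\mathrm{supp}(X)=\bigcup_{\rho\in X}\mathrm{supp}(\rho)$. $\mathcal S^q$ is the collection of nonempty finite subsets $X\ne\{1\}$ of $\mathrm{Sym}_f(\mathbb N)$ such that each $\rho\in X$ is a product of disjoint $q$-cycles and $\mathrm{supp}(\rho)=\mathrm{supp}(X)$ for every $\rho\in X$. Two sets are equivalent if they are conjugate under $\mathrm{Sym}(\mathbb N)$. For $X_1,\dots,X_s$ with pairwise disjoint supports, $X_1\times\cdots\times X_s=\{x_1\cdots x_s:x_i\in X_i\}$. $X*Y$ is $X'\times Y'$ where $X',Y'$ are equivalent to $X,Y$ and have disjoint supports (defined up to equivalence), and $*^sY=Y*\cdots*Y$ ($s$ factors). $X\in\mathcal S^q$ is irreducible if there are no $Y,Z\in\mathcal S^q$ with disjoint supports and $X=Y\times Z$. For $X\in\mathcal S^q$, $S_X$ is the pointwise stabilizer of $X$ under conjugation, i.e. the centralizer of $X$, in $G_X=\mathrm{Sym}(\mathrm{supp}\,X)$. *)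

theory Defs
  imports "HOL-Combinatorics.Perm" "HOL-Combinatorics.Cycles"
begin

text \<open>
  The group \<open>Sym\<^sub>f(\<nat>)\<close> of finitary permutations of the natural numbers is the library type
  \<open>nat perm\<close>; the support of a single permutation is \<open>affected\<close>.
\<close>

unbundle permutation_syntax

definition supp :: "nat perm set \<Rightarrow> nat set" where
  "supp X = (\<Union>\<rho>\<in>X. affected \<rho>)"

definition is_cycle :: "nat \<Rightarrow> nat perm \<Rightarrow> bool" where
  "is_cycle q \<sigma> \<longleftrightarrow>
     (\<exists>cs. distinct cs \<and> length cs = q \<and> (\<langle>$\<rangle>) \<sigma> = cycle_of_list cs)"

definition is_prod_of_disjoint_cycles :: "nat \<Rightarrow> nat perm \<Rightarrow> bool" where
  "is_prod_of_disjoint_cycles q \<rho> \<longleftrightarrow>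
     (\<exists>\<sigma>s. (\<forall>\<sigma>\<in>set \<sigma>s. is_cycle q \<sigma>) \<and>
           sorted_wrt (\<lambda>\<sigma> \<tau>. affected \<sigma> \<inter> affected \<tau> = {}) \<sigma>s \<and>
           \<rho> = prod_list \<sigma>s)"

text \<open>The collection \<open>\<S>\<^sup>q\<close>.\<close>

definition cycle_sets :: "nat \<Rightarrow> nat perm set set" where
  "cycle_sets q = {X. finite X \<and> X \<noteq> {} \<and> X \<noteq> {1} \<and>
     (\<forall>\<rho>\<in>X. is_prod_of_disjoint_cycles q \<rho> \<and> affected \<rho> = supp X)}"

text \<open>
  Conjugation under the full group \<open>Sym(\<nat>)\<close>: the bijection \<open>f\<close> need not be finitary,
  so conjugates are compared as functions.
\<close>

definition equivalent :: "nat perm set \<Rightarrow> nat perm set \<Rightarrow> bool" where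
  "equivalent X Y \<longleftrightarrow>
     (\<exists>f. bij f \<and> (\<langle>$\<rangle>) ` Y = (\<lambda>\<rho>. f \<circ> (\<langle>$\<rangle>) \<rho> \<circ> inv f) ` X)"

text \<open>Since the relation is symmetric, \<open>sorted_wrt\<close> expresses pairwise disjointness
  over all pairs of distinct positions.\<close>

definition disjoint_supports :: "nat perm set list \<Rightarrow> bool" where
  "disjoint_supports Xs \<longleftrightarrow> sorted_wrt (\<lambda>X Y. supp X \<inter> supp Y = {}) Xs"

text \<open>
  \<open>X\<^sub>1 \<times> \<dots> \<times> X\<^sub>s = {x\<^sub>1 \<cdots> x\<^sub>s | x\<^sub>i \<in> X\<^sub>i}\<close>; only meaningful together with \<open>disjoint_supports\<close>.
\<close>

definition set_product :: "nat perm set list \<Rightarrow> nat perm set" where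
  "set_product Xs = prod_list ` listset Xs"

text \<open>\<open>*\<^sup>s Y\<close> is defined only up to equivalence; this is the class of all its representatives.\<close>

definition star_power :: "nat \<Rightarrow> nat perm set \<Rightarrow> nat perm set set" where
  "star_power s Y = {set_product Ys | Ys.
     length Ys = s \<and> (\<forall>Y'\<in>set Ys. equivalent Y' Y) \<and> disjoint_supports Ys}"

definition irreducible_set :: "nat \<Rightarrow> nat perm set \<Rightarrow> bool" where
  "irreducible_set q X \<longleftrightarrow> X \<in> cycle_sets q \<and>
     \<not> (\<exists>Y\<in>cycle_sets q. \<exists>Z\<in>cycle_sets q.
          disjoint_supports [Y, Z] \<and> X = set_product [Y, Z])"

text \<open>\<open>G\<^sub>X = Sym(supp X)\<close> and the pointwise stabilizer \<open>S\<^sub>X\<close> of \<open>X\<close> in it under conjugation.\<close>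

definition sym_supp :: "nat perm set \<Rightarrow> nat perm set" where
  "sym_supp X = {g. affected g \<subseteq> supp X}"

definition stabilizer :: "nat perm set \<Rightarrow> nat perm set" where
  "stabilizer X = {g \<in> sym_supp X. \<forall>x\<in>X. g * x * inverse g = x}"

end

theory Submission
  imports Defs
begin

text \<open>
  Let \<open>X = X\<^sub>1 \<times> \<dots> \<times> X\<^sub>s\<close>. A product of elements of the stabilizers of the factors clearly stabilizes
  \<open>X\<close>. The content lies in the converse: a permutation \<open>g\<close> that commutes with every element of
  \<open>X\<close> might a priori move points from one factor's support to another's, and it splits as a
  product of elements of the single stabilizers exactly when it preserves every \<open>supp X\<^sub>i\<close>.

  Irreducibility of \<open>Y\<close> excludes such mixing. Call a nonempty \<open>A \<subseteq> supp Y\<close> a common block of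
  \<open>Y\<close> if it is invariant under all elements of \<open>Y\<close> and they all act on it in the same way.
  If there were a common block \<open>A\<close>, with common action \<open>c\<close>, then \<open>Y = W \<times> {c}\<close>, where \<open>W\<close> is
  obtained by restricting the elements of \<open>Y\<close> to the complement of \<open>A\<close>; as \<open>Y\<close> has at
  least two elements, \<open>A\<close> is not all of \<open>supp Y\<close>, so both factors are admissible and \<open>Y\<close> is
  reducible (\<open>irreducible_no_common_block\<close>).

  On the other hand, if \<open>g\<close> commutes with all of \<open>X\<close>, then the set \<open>A\<close> of the points of
  \<open>supp X\<^sub>i\<close> that \<open>g\<close> carries out of \<open>supp X\<^sub>i\<close> has all the properties of a common block
  of \<open>X\<^sub>i\<close>, except possibly being nonempty: as \<open>x\<close> runs through \<open>X\<^sub>i\<close> while the other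
  coordinates are held fixed, the action outside \<open>supp X\<^sub>i\<close> stays the same, and conjugation by
  \<open>g\<close> transports this to \<open>A\<close>. Hence \<open>A\<close> is empty
  (\<open>commuting_preserves_supports\<close>), and the stabilizer of the product is the product of the
  stabilizers (\<open>stabilizer_set_product\<close>). Since everything is transported by conjugation, this
  applies to copies of \<open>Y\<close>, and the stabilizers of the copies are copies of the stabilizer
  of \<open>Y\<close>.
\<close>

section \<open>Permutations of bounded support\<close>

definition restrict_perm :: "'a set \<Rightarrow> 'a perm \<Rightarrow> 'a perm" where
  "restrict_perm A \<rho> = Perm (\<lambda>p. if p \<in> A then \<rho> \<langle>$\<rangle> p else p)"

lemma apply_restrict_perm:
  assumes "(\<langle>$\<rangle>) \<rho> ` A = A"
  shows "restrict_perm A \<rho> \<langle>$\<rangle> p = (if p \<in> A then \<rho> \<langle>$\<rangle> p else p)"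
proof -
  let ?f = "\<lambda>p. if p \<in> A then \<rho> \<langle>$\<rangle> p else p"
  have "inj ?f"
    using assms by (auto simp: inj_def apply_inj)
  moreover have "q \<in> range ?f" for q
    using assms by (cases "q \<in> A") (auto simp: image_iff)
  ultimately have "bij ?f"
    by (auto simp: bij_def)
  moreover have "{p. ?f p \<noteq> p} \<subseteq> affected \<rho>"
    by (auto simp: in_affected)
  then have "finite {p. ?f p \<noteq> p}"
    by (rule finite_subset) simp
  ultimately show ?thesis
    unfolding restrict_perm_def by (simp add: Perm_inverse)
qed

lemma affected_restrict_perm:
  assumes "(\<langle>$\<rangle>) \<rho> ` A = A"
  shows "affected (restrict_perm A \<rho>) = affected \<rho> \<inter> A"
  using assms by (auto simp: in_affected apply_restrict_perm split: if_splits)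

lemma perm_image_eq_if_subset:
  assumes "finite A" "(\<langle>$\<rangle>) \<rho> ` A \<subseteq> A"
  shows "(\<langle>$\<rangle>) \<rho> ` A = A"
  using assms by (intro endo_inj_surj) (auto simp: inj_on_def apply_inj)

lemma perm_image_Compl:
  assumes "(\<langle>$\<rangle>) \<rho> ` A = A"
  shows "(\<langle>$\<rangle>) \<rho> ` (- A) = - A"
  using assms by (simp add: bij_image_Compl_eq)

lemma apply_in_iff_of_affected_subset:
  assumes "affected \<rho> \<subseteq> B"
  shows "\<rho> \<langle>$\<rangle> p \<in> B \<longleftrightarrow> p \<in> B"
  using assms by (metis apply_affected in_affected subsetD)

lemma prod_list_outside:
  assumes "\<forall>\<sigma>\<in>set \<sigma>s. p \<notin> affected \<sigma>"
  shows "prod_list \<sigma>s \<langle>$\<rangle> p = p"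
  using assms by (induction \<sigma>s) (auto simp: in_affected apply_times)

text \<open>
  Factors living on disjoint blocks do not interfere. The blocks are allowed to be larger than the
  supports of the factors because an element of a stabilizer may fix points of its block.
\<close>

lemma prod_list_in_block:
  assumes "list_all2 (\<lambda>\<sigma> B. affected \<sigma> \<subseteq> B) \<sigma>s Bs"
    and "sorted_wrt (\<lambda>B C. B \<inter> C = {}) Bs"
    and "i < length Bs" "p \<in> Bs ! i"
  shows "prod_list \<sigma>s \<langle>$\<rangle> p = (\<sigma>s ! i) \<langle>$\<rangle> p"
  using assms
proof (induction arbitrary: i rule: list_all2_induct)
  case Nil
  then show ?case by simp
next
  case (Cons \<sigma> \<sigma>s B Bs)
  show ?case
  proof (cases i)
    case 0
    have "p \<notin> affected \<tau>" if \<tau>: "\<tau> \<in> set \<sigma>s" for \<tau>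
    proof -
      obtain k where "k < length \<sigma>s" "\<tau> = \<sigma>s ! k"
        using \<tau> by (auto simp: in_set_conv_nth)
      then have "affected \<tau> \<subseteq> Bs ! k" "Bs ! k \<in> set Bs"
        using Cons.hyps(2) by (simp_all add: list_all2_conv_all_nth)
      then show ?thesis using Cons.prems 0 by auto
    qed
    then show ?thesis
      using 0 by (simp add: apply_times prod_list_outside)
  next
    case (Suc j)
    then have j: "j < length Bs" "p \<in> Bs ! j" "Bs ! j \<in> set Bs"
      using Cons.prems by auto
    have prod: "prod_list \<sigma>s \<langle>$\<rangle> p = (\<sigma>s ! j) \<langle>$\<rangle> p"
      using Cons.IH Cons.prems j by simp
    have "affected (\<sigma>s ! j) \<subseteq> Bs ! j"
      using Cons.hyps(2) j by (simp add: list_all2_conv_all_nth)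
    then have "(\<sigma>s ! j) \<langle>$\<rangle> p \<in> Bs ! j"
      using j by (simp add: apply_in_iff_of_affected_subset)
    moreover have "B \<inter> Bs ! j = {}"
      using j Cons.prems by simp
    ultimately have "(\<sigma>s ! j) \<langle>$\<rangle> p \<notin> affected \<sigma>"
      using Cons.hyps(1) by blast
    then show ?thesis
      using Suc prod by (simp add: apply_times in_affected)
  qed
qed

lemma prod_list_disjoint:
  assumes "sorted_wrt (\<lambda>\<sigma> \<tau>. affected \<sigma> \<inter> affected \<tau> = {}) \<sigma>s"
    and "\<sigma> \<in> set \<sigma>s" "p \<in> affected \<sigma>"
  shows "prod_list \<sigma>s \<langle>$\<rangle> p = \<sigma> \<langle>$\<rangle> p"
proof -
  obtain i where "i < length \<sigma>s" "\<sigma> = \<sigma>s ! i"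
    using assms(2) by (auto simp: in_set_conv_nth)
  then show ?thesis
    using assms prod_list_in_block[of \<sigma>s "map affected \<sigma>s" i p]
    by (simp add: sorted_wrt_map list_all2_conv_all_nth)
qed

lemma is_cycle_single_orbit:
  assumes "is_cycle q \<sigma>" "p \<in> affected \<sigma>" "r \<in> affected \<sigma>"
  obtains n where "r = ((\<langle>$\<rangle>) \<sigma> ^^ n) p"
proof -
  obtain cs where cs: "distinct cs" "(\<langle>$\<rangle>) \<sigma> = cycle_of_list cs"
    using assms(1) by (auto simp: is_cycle_def)
  have "p \<in> set cs" "r \<in> set cs"
    using assms(2,3) id_outside_supp[of p cs] id_outside_supp[of r cs] by (auto simp: in_affected cs(2))
  then obtain i j where ij: "i < length cs" "p = cs ! i" "j < length cs" "r = cs ! j"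
    by (auto simp: in_set_conv_nth)
  \<comment> \<open>rotating from position \<open>i\<close> to position \<open>j\<close>, once around the list so as not to need \<open>i \<le> j\<close>\<close>
  define n where "n = length cs - i + j"
  have "((\<langle>$\<rangle>) \<sigma> ^^ n) p = rotate n cs ! i"
    using cyclic_rotation[OF cs(1), of n] ij cs(2) by (metis nth_map)
  also have "\<dots> = r"
    using ij by (simp add: nth_rotate n_def)
  finally show ?thesis
    using that by metis
qed

text \<open>
  A cycle moves its points in a single orbit, so an invariant set contains all of it or none of
  it. Restricting to the invariant set therefore amounts to keeping some of the cycles.
\<close>

lemma is_prod_of_disjoint_cycles_restrict:
  assumes "is_prod_of_disjoint_cycles q \<rho>" and inv: "(\<langle>$\<rangle>) \<rho> ` A = A"
  shows "is_prod_of_disjoint_cycles q (restrict_perm A \<rho>)"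
proof -
  obtain \<sigma>s where \<sigma>s: "\<forall>\<sigma>\<in>set \<sigma>s. is_cycle q \<sigma>"
      "sorted_wrt (\<lambda>\<sigma> \<tau>. affected \<sigma> \<inter> affected \<tau> = {}) \<sigma>s" "\<rho> = prod_list \<sigma>s"
    using assms(1) by (auto simp: is_prod_of_disjoint_cycles_def)
  define \<tau>s where "\<tau>s = filter (\<lambda>\<sigma>. affected \<sigma> \<subseteq> A) \<sigma>s"
  have sorted: "sorted_wrt (\<lambda>\<sigma> \<tau>. affected \<sigma> \<inter> affected \<tau> = {}) \<tau>s"
    unfolding \<tau>s_def using \<sigma>s(2) by (rule sorted_wrt_filter)
  have whole: "affected \<sigma> \<subseteq> A" if \<sigma>: "\<sigma> \<in> set \<sigma>s" "p \<in> affected \<sigma>" "p \<in> A" for \<sigma> p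
  proof
    fix r assume "r \<in> affected \<sigma>"
    then obtain n where n: "r = ((\<langle>$\<rangle>) \<sigma> ^^ n) p"
      using is_cycle_single_orbit \<sigma> \<sigma>s(1) by blast
    have "((\<langle>$\<rangle>) \<sigma> ^^ n) p \<in> A \<inter> affected \<sigma>"
    proof (induction n)
      case 0
      then show ?case using \<sigma> by simp
    next
      case (Suc n)
      then have "\<sigma> \<langle>$\<rangle> (((\<langle>$\<rangle>) \<sigma> ^^ n) p) = \<rho> \<langle>$\<rangle> (((\<langle>$\<rangle>) \<sigma> ^^ n) p)"
        using prod_list_disjoint[OF \<sigma>s(2) \<sigma>(1)] \<sigma>s(3) by simp
      moreover have "\<rho> \<langle>$\<rangle> (((\<langle>$\<rangle>) \<sigma> ^^ n) p) \<in> A"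
        using Suc inv by blast
      moreover have "\<sigma> \<langle>$\<rangle> (((\<langle>$\<rangle>) \<sigma> ^^ n) p) \<in> affected \<sigma>"
        using Suc by simp
      ultimately show ?case by simp
    qed
    then show "r \<in> A" using n by simp
  qed
  have "restrict_perm A \<rho> = prod_list \<tau>s"
  proof (rule perm_eqI)
    fix p
    show "restrict_perm A \<rho> \<langle>$\<rangle> p = prod_list \<tau>s \<langle>$\<rangle> p"
    proof (cases "\<exists>\<sigma>\<in>set \<tau>s. p \<in> affected \<sigma>")
      case True
      then obtain \<sigma> where \<sigma>: "\<sigma> \<in> set \<tau>s" "p \<in> affected \<sigma>" by blast
      then have "\<sigma> \<in> set \<sigma>s" "p \<in> A" by (auto simp: \<tau>s_def)
      then have "\<rho> \<langle>$\<rangle> p = \<sigma> \<langle>$\<rangle> p"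
        using prod_list_disjoint[OF \<sigma>s(2)] \<sigma> \<sigma>s(3) by simp
      then show ?thesis
        using prod_list_disjoint[OF sorted \<sigma>] \<open>p \<in> A\<close> by (simp add: apply_restrict_perm[OF inv])
    next
      case False
      then have "p \<in> A \<Longrightarrow> \<rho> \<langle>$\<rangle> p = p"
        unfolding \<sigma>s(3) using whole by (intro prod_list_outside) (auto simp: \<tau>s_def)
      then show ?thesis
        using False by (simp add: apply_restrict_perm[OF inv] prod_list_outside)
    qed
  qed
  moreover have "\<forall>\<sigma>\<in>set \<tau>s. is_cycle q \<sigma>"
    using \<sigma>s(1) by (simp add: \<tau>s_def)
  ultimately show ?thesis
    using sorted unfolding is_prod_of_disjoint_cycles_def by blast
qed

section \<open>Irreducible sets have no common block\<close>

definition common_block :: "nat perm set \<Rightarrow> nat set \<Rightarrow> bool" where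
  "common_block X A \<longleftrightarrow> A \<noteq> {} \<and> A \<subseteq> supp X \<and>
     (\<forall>x\<in>X. \<forall>p\<in>A. x \<langle>$\<rangle> p \<in> A) \<and> (\<forall>x\<in>X. \<forall>y\<in>X. \<forall>p\<in>A. x \<langle>$\<rangle> p = y \<langle>$\<rangle> p)"

text \<open>
  Splitting off the action on a common block would be a factorization. Without the bound on
  \<open>card Y\<close> this fails: the block could be the whole support of a singleton, which leaves
  the forbidden factor \<open>{1}\<close>.
\<close>

lemma irreducible_no_common_block:
  assumes "irreducible_set q Y" "card Y > 1"
  shows "\<not> common_block Y A"
proof
  assume block: "common_block Y A"
  have Y: "finite Y" "Y \<noteq> {}" "\<And>x. x \<in> Y \<Longrightarrow> is_prod_of_disjoint_cycles q x"
      "\<And>x. x \<in> Y \<Longrightarrow> affected x = supp Y"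
    using assms(1) by (auto simp: irreducible_set_def cycle_sets_def)
  have A: "A \<noteq> {}" "A \<subseteq> supp Y" "\<And>x p. x \<in> Y \<Longrightarrow> p \<in> A \<Longrightarrow> x \<langle>$\<rangle> p \<in> A"
      "\<And>x y p. x \<in> Y \<Longrightarrow> y \<in> Y \<Longrightarrow> p \<in> A \<Longrightarrow> x \<langle>$\<rangle> p = y \<langle>$\<rangle> p"
    using block unfolding common_block_def by blast+
  have "finite A"
    using A(2) Y(1) by (auto simp: supp_def intro: finite_subset)
  then have inv: "(\<langle>$\<rangle>) x ` A = A" if "x \<in> Y" for x
    using A(3) that by (intro perm_image_eq_if_subset) auto
  then have inv': "(\<langle>$\<rangle>) x ` (- A) = - A" if "x \<in> Y" for x
    using that by (intro perm_image_Compl)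
  obtain x0 where x0: "x0 \<in> Y" using Y(2) by blast
  define c where "c = restrict_perm A x0"
  define W where "W = restrict_perm (- A) ` Y"
  have apply_c: "c \<langle>$\<rangle> p = (if p \<in> A then x \<langle>$\<rangle> p else p)" if "x \<in> Y" for x p
    using A(4)[OF x0 that] by (simp add: c_def apply_restrict_perm[OF inv[OF x0]])
  have affected_c: "affected c = A"
    using A(2) Y(4)[OF x0] by (auto simp: c_def affected_restrict_perm[OF inv[OF x0]])
  have affected_w: "affected w = supp Y - A" if "w \<in> W" for w
    using that Y(4) by (auto simp: W_def affected_restrict_perm[OF inv'])
  then have supp_W: "supp W = supp Y - A"
    using Y(2) by (auto simp: supp_def W_def)
  have "A \<noteq> supp Y"
  proof
    assume "A = supp Y"
    then have "x \<langle>$\<rangle> p = x0 \<langle>$\<rangle> p" if "x \<in> Y" for x p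
      using A(4)[OF that x0] Y(4)[OF that] Y(4)[OF x0] by (metis in_affected)
    then have "Y \<subseteq> {x0}" by (auto intro: perm_eqI)
    then have "card Y \<le> 1" using card_mono[of "{x0}" Y] by simp
    then show False using assms(2) by simp
  qed
  then have "supp W \<noteq> {}" using A(2) supp_W by auto
  then have "W \<noteq> {1}" by (auto simp: supp_def)
  moreover have "is_prod_of_disjoint_cycles q w" if "w \<in> W" for w
    using that is_prod_of_disjoint_cycles_restrict[OF Y(3) inv'] by (auto simp: W_def)
  ultimately have "W \<in> cycle_sets q"
    using Y(1,2) affected_w supp_W by (auto simp: cycle_sets_def W_def)
  moreover have "is_prod_of_disjoint_cycles q c"
    unfolding c_def using Y(3) inv x0 by (intro is_prod_of_disjoint_cycles_restrict)
  then have "{c} \<in> cycle_sets q"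
    using affected_c A(1) by (auto simp: cycle_sets_def supp_def)
  moreover have "disjoint_supports [W, {c}]"
    using supp_W affected_c by (auto simp: disjoint_supports_def supp_def)
  moreover have "restrict_perm (- A) x * c = x" if "x \<in> Y" for x
    using A(3)[OF that] inv'[OF that]
    by (intro perm_eqI) (simp add: apply_times apply_restrict_perm apply_c[OF that])
  then have "Y = set_product [W, {c}]"
    unfolding set_product_def W_def by (force simp: set_Cons_def image_iff)
  ultimately show False
    using assms(1) unfolding irreducible_set_def by blast
qed

section \<open>Stabilizers and conjugation\<close>

text \<open>
  Commutation is stated pointwise because all later arguments follow single points through the
  blocks.
\<close>

lemma mem_stabilizer_iff:
  "g \<in> stabilizer X \<longleftrightarrow>
     affected g \<subseteq> supp X \<and> (\<forall>x\<in>X. \<forall>p. g \<langle>$\<rangle> (x \<langle>$\<rangle> p) = x \<langle>$\<rangle> (g \<langle>$\<rangle> p))"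
proof -
  have "g * x * inverse g = x \<longleftrightarrow> (\<forall>p. g \<langle>$\<rangle> (x \<langle>$\<rangle> p) = x \<langle>$\<rangle> (g \<langle>$\<rangle> p))" for x
  proof -
    have "g * x * inverse g = x \<longleftrightarrow> (\<forall>p. g \<langle>$\<rangle> (x \<langle>$\<rangle> (inv ((\<langle>$\<rangle>) g) p)) = x \<langle>$\<rangle> p)"
      by (simp add: perm_eq_iff apply_times apply_inverse)
    also have "\<dots> \<longleftrightarrow> (\<forall>p. g \<langle>$\<rangle> (x \<langle>$\<rangle> p) = x \<langle>$\<rangle> (g \<langle>$\<rangle> p))"
    proof safe
      fix p assume "\<forall>p. g \<langle>$\<rangle> (x \<langle>$\<rangle> (inv ((\<langle>$\<rangle>) g) p)) = x \<langle>$\<rangle> p"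
      then show "g \<langle>$\<rangle> (x \<langle>$\<rangle> p) = x \<langle>$\<rangle> (g \<langle>$\<rangle> p)"
        using inv_f_f[OF bij_is_inj[OF bij_apply]] by metis
    next
      fix p assume "\<forall>p. g \<langle>$\<rangle> (x \<langle>$\<rangle> p) = x \<langle>$\<rangle> (g \<langle>$\<rangle> p)"
      then show "g \<langle>$\<rangle> (x \<langle>$\<rangle> (inv ((\<langle>$\<rangle>) g) p)) = x \<langle>$\<rangle> p"
        by (simp add: surj_f_inv_f bij_is_surj)
    qed
    finally show ?thesis .
  qed
  then show ?thesis by (auto simp: stabilizer_def sym_supp_def)
qed

lemma affected_subset_supp_if_stabilizer: "g \<in> stabilizer X \<Longrightarrow> affected g \<subseteq> supp X"
  by (simp add: stabilizer_def sym_supp_def)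

text \<open>
  The bijection \<open>f\<close> may move infinitely many points, so conjugation by it is not
  conjugation by an element of the group \<open>'a perm\<close>.
\<close>

definition conj_perm :: "('a \<Rightarrow> 'a) \<Rightarrow> 'a perm \<Rightarrow> 'a perm" where
  "conj_perm f \<rho> = Perm (f \<circ> (\<langle>$\<rangle>) \<rho> \<circ> inv f)"

lemma apply_conj_perm:
  assumes "bij f"
  shows "(\<langle>$\<rangle>) (conj_perm f \<rho>) = f \<circ> (\<langle>$\<rangle>) \<rho> \<circ> inv f"
proof -
  have "bij (f \<circ> (\<langle>$\<rangle>) \<rho> \<circ> inv f)"
    using assms by (intro bij_comp bij_imp_bij_inv) auto
  moreover have "{a. (f \<circ> (\<langle>$\<rangle>) \<rho> \<circ> inv f) a \<noteq> a} \<subseteq> f ` affected \<rho>"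
  proof
    fix a assume a: "a \<in> {a. (f \<circ> (\<langle>$\<rangle>) \<rho> \<circ> inv f) a \<noteq> a}"
    have "f (inv f a) = a"
      using assms by (simp add: bij_is_surj surj_f_inv_f)
    then show "a \<in> f ` affected \<rho>"
      using a by (intro image_eqI[of _ _ "inv f a"]) (auto simp: in_affected)
  qed
  then have "finite {a. (f \<circ> (\<langle>$\<rangle>) \<rho> \<circ> inv f) a \<noteq> a}"
    by (rule finite_subset) simp
  ultimately show ?thesis
    unfolding conj_perm_def by (simp add: Perm_inverse)
qed

lemma apply_conj_perm_image:
  assumes "bij f"
  shows "conj_perm f \<rho> \<langle>$\<rangle> (f p) = f (\<rho> \<langle>$\<rangle> p)"
  using assms by (simp add: apply_conj_perm bij_is_inj)

lemma conj_perm_inv [simp]: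
  assumes "bij f"
  shows "conj_perm (inv f) (conj_perm f \<rho>) = \<rho>" "conj_perm f (conj_perm (inv f) \<rho>) = \<rho>"
  using assms
  by (auto intro!: perm_eqI simp: apply_conj_perm bij_imp_bij_inv inv_inv_eq bij_is_inj
      bij_is_surj surj_f_inv_f)

lemma affected_conj_perm:
  assumes "bij f"
  shows "affected (conj_perm f \<rho>) = f ` affected \<rho>"
proof -
  have *: "f p \<in> affected (conj_perm f \<rho>) \<longleftrightarrow> p \<in> affected \<rho>" for p
    using assms by (simp add: in_affected apply_conj_perm_image bij_is_inj inj_eq)
  show ?thesis
  proof (rule set_eqI)
    fix a
    obtain p where "a = f p"
      using bij_is_surj[OF assms] by (rule surjE)
    then show "a \<in> affected (conj_perm f \<rho>) \<longleftrightarrow> a \<in> f ` affected \<rho>"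
      using * assms by (auto dest: bij_is_inj injD)
  qed
qed

lemma supp_conj:
  assumes "bij f"
  shows "supp (conj_perm f ` X) = f ` supp X"
  using assms by (auto simp: supp_def affected_conj_perm)

lemma equivalent_iff_conj_perm:
  "equivalent X Y \<longleftrightarrow> (\<exists>f. bij f \<and> Y = conj_perm f ` X)"
proof -
  have "(\<langle>$\<rangle>) ` Y = (\<lambda>\<rho>. f \<circ> (\<langle>$\<rangle>) \<rho> \<circ> inv f) ` X \<longleftrightarrow> Y = conj_perm f ` X" if "bij f" for f
  proof -
    have "(\<lambda>\<rho>. f \<circ> (\<langle>$\<rangle>) \<rho> \<circ> inv f) ` X = (\<langle>$\<rangle>) ` conj_perm f ` X"
      using that by (simp only: image_image apply_conj_perm)
    moreover have "inj ((\<langle>$\<rangle>) :: nat perm \<Rightarrow> _)"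
      by (simp add: inj_def apply_inject)
    ultimately show ?thesis by (simp only: inj_image_eq_iff)
  qed
  then show ?thesis unfolding equivalent_def by (simp cong: conj_cong)
qed

lemma conj_perm_mem_stabilizer:
  assumes "bij f" "g \<in> stabilizer X"
  shows "conj_perm f g \<in> stabilizer (conj_perm f ` X)"
proof -
  have "conj_perm f g \<langle>$\<rangle> (conj_perm f x \<langle>$\<rangle> p) = conj_perm f x \<langle>$\<rangle> (conj_perm f g \<langle>$\<rangle> p)"
    if "x \<in> X" for x p
  proof -
    obtain r where "p = f r"
      using bij_is_surj[OF assms(1)] by (rule surjE)
    moreover have "g \<langle>$\<rangle> (x \<langle>$\<rangle> r) = x \<langle>$\<rangle> (g \<langle>$\<rangle> r)"
      using assms(2) that unfolding mem_stabilizer_iff by blast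
    ultimately show ?thesis
      by (simp only: apply_conj_perm_image[OF assms(1)])
  qed
  moreover have "affected (conj_perm f g) \<subseteq> supp (conj_perm f ` X)"
    using assms unfolding mem_stabilizer_iff supp_conj[OF assms(1)] affected_conj_perm[OF assms(1)]
    by blast
  ultimately show ?thesis
    unfolding mem_stabilizer_iff by blast
qed

lemma stabilizer_conj:
  assumes "bij f"
  shows "stabilizer (conj_perm f ` X) = conj_perm f ` stabilizer X"
proof
  show "conj_perm f ` stabilizer X \<subseteq> stabilizer (conj_perm f ` X)"
    by (rule image_subsetI) (rule conj_perm_mem_stabilizer[OF assms])
  show "stabilizer (conj_perm f ` X) \<subseteq> conj_perm f ` stabilizer X"
  proof
    fix h assume "h \<in> stabilizer (conj_perm f ` X)"
    from conj_perm_mem_stabilizer[OF bij_imp_bij_inv[OF assms] this]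
    have "conj_perm (inv f) h \<in> stabilizer X"
      by (simp only: image_image conj_perm_inv(1)[OF assms] image_ident)
    then show "h \<in> conj_perm f ` stabilizer X"
      by (intro image_eqI[of h "conj_perm f" "conj_perm (inv f) h"])
        (simp_all only: conj_perm_inv(2)[OF assms])
  qed
qed

lemma common_block_conj:
  assumes "bij f" "common_block X A"
  shows "common_block (conj_perm f ` X) (f ` A)"
proof -
  have "f ` A \<noteq> {}" "f ` A \<subseteq> supp (conj_perm f ` X)"
    using assms(2) unfolding common_block_def supp_conj[OF assms(1)] by blast+
  moreover have "y \<langle>$\<rangle> r \<in> f ` A" if yr: "y \<in> conj_perm f ` X" "r \<in> f ` A" for y r
  proof -
    obtain x p where x: "x \<in> X" "y = conj_perm f x" "p \<in> A" "r = f p"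
      using yr by (elim imageE)
    have "x \<langle>$\<rangle> p \<in> A"
      using assms(2) x(1,3) unfolding common_block_def by blast
    then show ?thesis
      unfolding x(2,4) apply_conj_perm_image[OF assms(1)] by (rule imageI)
  qed
  moreover have "y \<langle>$\<rangle> r = z \<langle>$\<rangle> r"
    if yzr: "y \<in> conj_perm f ` X" "z \<in> conj_perm f ` X" "r \<in> f ` A" for y z r
  proof -
    obtain x p where x: "x \<in> X" "y = conj_perm f x" "p \<in> A" "r = f p"
      using yzr(1,3) by (elim imageE)
    obtain w where w: "w \<in> X" "z = conj_perm f w"
      using yzr(2) by (elim imageE)
    have "x \<langle>$\<rangle> p = w \<langle>$\<rangle> p"
      using assms(2) x(1,3) w(1) unfolding common_block_def by blast
    then show ?thesis
      by (simp only: x w apply_conj_perm_image[OF assms(1)])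
  qed
  ultimately show ?thesis
    unfolding common_block_def by blast
qed

section \<open>Stabilizers of products\<close>

lemma mem_listset_iff: "xs \<in> listset As \<longleftrightarrow> list_all2 (\<in>) xs As"
  by (induction As arbitrary: xs) (auto simp: set_Cons_def list_all2_Cons2)

lemma affected_subset_supp: "x \<in> X \<Longrightarrow> affected x \<subseteq> supp X"
  by (auto simp: supp_def)

lemma listset_block_action:
  assumes "list_all2 (\<lambda>x X. affected x \<subseteq> supp X) xs Xs" "disjoint_supports Xs"
    and "i < length Xs" "p \<in> supp (Xs ! i)"
  shows "prod_list xs \<langle>$\<rangle> p = (xs ! i) \<langle>$\<rangle> p"
  using assms prod_list_in_block[of xs "map supp Xs" i p]
  by (simp add: disjoint_supports_def sorted_wrt_map list_all2_conv_all_nth)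

lemma listset_outside_action:
  assumes "list_all2 (\<lambda>x X. affected x \<subseteq> supp X) xs Xs" "\<forall>X\<in>set Xs. p \<notin> supp X"
  shows "prod_list xs \<langle>$\<rangle> p = p"
  using assms by (intro prod_list_outside) (fastforce simp: list_all2_conv_all_nth in_set_conv_nth)

lemma listset_affected:
  "xs \<in> listset Xs \<Longrightarrow> list_all2 (\<lambda>x X. affected x \<subseteq> supp X) xs Xs"
  unfolding mem_listset_iff by (erule list_all2_mono) (rule affected_subset_supp)

text \<open>
  A base point \<open>zs\<close> of the product in which a single coordinate can be varied freely: comparing
  two elements that differ in one coordinate isolates the action of one factor.
\<close>

lemma listset_through:
  assumes "\<forall>X\<in>set Xs. X \<noteq> {}"
  obtains zs where "\<And>i x. i < length Xs \<Longrightarrow> x \<in> Xs ! i \<Longrightarrow> zs[i := x] \<in> listset Xs"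
    and "zs \<in> listset Xs"
proof -
  define zs where "zs = map (\<lambda>X. SOME x. x \<in> X) Xs"
  have "zs \<in> listset Xs"
    using assms by (auto simp: zs_def mem_listset_iff list_all2_conv_all_nth some_in_eq)
  moreover from this have "zs[i := x] \<in> listset Xs" if "i < length Xs" "x \<in> Xs ! i" for i x
    using that by (auto simp: mem_listset_iff list_all2_conv_all_nth nth_list_update)
  ultimately show ?thesis using that by blast
qed

lemma supp_set_product:
  assumes "disjoint_supports Xs" "\<forall>X\<in>set Xs. X \<noteq> {}"
  shows "supp (set_product Xs) = (\<Union>X\<in>set Xs. supp X)"
proof
  show "supp (set_product Xs) \<subseteq> (\<Union>X\<in>set Xs. supp X)"
    using listset_outside_action[OF listset_affected]
    by (auto simp: supp_def set_product_def in_affected) blast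
  show "(\<Union>X\<in>set Xs. supp X) \<subseteq> supp (set_product Xs)"
  proof
    fix p assume "p \<in> (\<Union>X\<in>set Xs. supp X)"
    then obtain i where i: "i < length Xs" "p \<in> supp (Xs ! i)"
      by (auto simp: in_set_conv_nth)
    then obtain x where x: "x \<in> Xs ! i" "x \<langle>$\<rangle> p \<noteq> p"
      by (auto simp: supp_def in_affected)
    obtain zs where zs: "zs[i := x] \<in> listset Xs" "zs \<in> listset Xs"
      using listset_through[OF assms(2)] i(1) x(1) by metis
    then have "length zs = length Xs"
      by (simp add: mem_listset_iff list_all2_lengthD)
    then have "prod_list (zs[i := x]) \<langle>$\<rangle> p = x \<langle>$\<rangle> p"
      using listset_block_action[OF listset_affected[OF zs(1)] assms(1) i] i(1) by simp
    then show "p \<in> supp (set_product Xs)"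
      using x(2) zs(1) by (force simp: supp_def set_product_def in_affected)
  qed
qed

text \<open>
  For \<open>x \<in> X\<^sub>i\<close> let \<open>P x\<close> be the product of \<open>x\<close> with fixed elements of the other factors.
  If \<open>r \<in> supp X\<^sub>i\<close>, then \<open>g (x r) = g (P x r) = P x (g r)\<close>. When \<open>g r\<close> lies outside
  \<open>supp X\<^sub>i\<close>, the right-hand side is also outside, and it does not depend on \<open>x\<close>. So the points
  that \<open>g\<close> carries out of \<open>supp X\<^sub>i\<close> would, if there were any, form a common block.
\<close>

lemma commuting_preserves_supports:
  assumes "disjoint_supports Xs" "\<forall>X\<in>set Xs. X \<noteq> {}"
    and comm: "\<And>x p. x \<in> set_product Xs \<Longrightarrow> g \<langle>$\<rangle> (x \<langle>$\<rangle> p) = x \<langle>$\<rangle> (g \<langle>$\<rangle> p)"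
    and i: "i < length Xs" "\<And>A. \<not> common_block (Xs ! i) A"
    and "p \<in> supp (Xs ! i)"
  shows "g \<langle>$\<rangle> p \<in> supp (Xs ! i)"
proof -
  define A where "A = {p \<in> supp (Xs ! i). g \<langle>$\<rangle> p \<notin> supp (Xs ! i)}"
  obtain zs where zs: "\<And>x. x \<in> Xs ! i \<Longrightarrow> zs[i := x] \<in> listset Xs" "zs \<in> listset Xs"
    using listset_through[OF assms(2)] i(1) by metis
  have len: "length zs = length Xs"
    using zs(2) by (simp add: mem_listset_iff list_all2_lengthD)
  define P where "P x = prod_list (zs[i := x])" for x
  have P_in: "P x \<langle>$\<rangle> r = x \<langle>$\<rangle> r" if "x \<in> Xs ! i" "r \<in> supp (Xs ! i)" for x r
    using listset_block_action[OF listset_affected[OF zs(1)[OF that(1)]] assms(1) i(1) that(2)]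
      i(1) len by (simp add: P_def)
  have P_out: "P x \<langle>$\<rangle> r = P y \<langle>$\<rangle> r"
    if xy: "x \<in> Xs ! i" "y \<in> Xs ! i" and r: "r \<notin> supp (Xs ! i)" for x y r
  proof (cases "\<exists>j<length Xs. r \<in> supp (Xs ! j)")
    case True
    then obtain j where j: "j < length Xs" "r \<in> supp (Xs ! j)" by blast
    then have "j \<noteq> i" using r by auto
    then show ?thesis
      using listset_block_action[OF listset_affected[OF zs(1)[OF xy(1)]] assms(1) j]
        listset_block_action[OF listset_affected[OF zs(1)[OF xy(2)]] assms(1) j]
      by (simp add: P_def)
  next
    case False
    then have out: "\<forall>X\<in>set Xs. r \<notin> supp X"
      by (auto simp: in_set_conv_nth)
    have "P x \<langle>$\<rangle> r = r" if "x \<in> Xs ! i" for x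
      unfolding P_def by (rule listset_outside_action[OF listset_affected[OF zs(1)[OF that]] out])
    then show ?thesis
      using xy by simp
  qed
  have P_stays_out: "P x \<langle>$\<rangle> r \<notin> supp (Xs ! i)" if x: "x \<in> Xs ! i" and r: "r \<notin> supp (Xs ! i)" for x r
  proof
    assume out: "P x \<langle>$\<rangle> r \<in> supp (Xs ! i)"
    obtain t where t: "P x \<langle>$\<rangle> r = x \<langle>$\<rangle> t"
      using bij_is_surj[OF bij_apply] by (rule surjE)
    have t_in: "t \<in> supp (Xs ! i)"
      using out unfolding t apply_in_iff_of_affected_subset[OF affected_subset_supp[OF x]] .
    have "P x \<langle>$\<rangle> r = P x \<langle>$\<rangle> t"
      unfolding t P_in[OF x t_in] ..
    then show False using r t_in unfolding apply_inj by blast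
  qed
  have comm': "g \<langle>$\<rangle> (x \<langle>$\<rangle> r) = P x \<langle>$\<rangle> (g \<langle>$\<rangle> r)" if "x \<in> Xs ! i" "r \<in> supp (Xs ! i)" for x r
  proof -
    have "P x \<in> set_product Xs"
      unfolding P_def set_product_def by (intro imageI zs(1) that)
    from comm[OF this] show ?thesis
      unfolding P_in[OF that, symmetric] .
  qed
  have "x \<langle>$\<rangle> r \<in> A" if x: "x \<in> Xs ! i" and r: "r \<in> A" for x r
  proof -
    have r': "r \<in> supp (Xs ! i)" "g \<langle>$\<rangle> r \<notin> supp (Xs ! i)"
      using r unfolding A_def by auto
    have "x \<langle>$\<rangle> r \<in> supp (Xs ! i)"
      unfolding apply_in_iff_of_affected_subset[OF affected_subset_supp[OF x]] by (rule r'(1))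
    moreover have "g \<langle>$\<rangle> (x \<langle>$\<rangle> r) \<notin> supp (Xs ! i)"
      unfolding comm'[OF x r'(1)] by (rule P_stays_out[OF x r'(2)])
    ultimately show ?thesis
      unfolding A_def by blast
  qed
  moreover have "x \<langle>$\<rangle> r = y \<langle>$\<rangle> r" if x: "x \<in> Xs ! i" and y: "y \<in> Xs ! i" and r: "r \<in> A" for x y r
  proof -
    have r': "r \<in> supp (Xs ! i)" "g \<langle>$\<rangle> r \<notin> supp (Xs ! i)"
      using r unfolding A_def by auto
    have "g \<langle>$\<rangle> (x \<langle>$\<rangle> r) = g \<langle>$\<rangle> (y \<langle>$\<rangle> r)"
      unfolding comm'[OF x r'(1)] comm'[OF y r'(1)] by (rule P_out[OF x y r'(2)])
    then show ?thesis unfolding apply_inj .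
  qed
  moreover have "A \<subseteq> supp (Xs ! i)"
    unfolding A_def by blast
  ultimately have "A = {}"
    using i(2)[of A] unfolding common_block_def by meson
  then show ?thesis using assms(6) unfolding A_def by blast
qed

text \<open>
  Once \<open>g\<close> is known to preserve every support, its components are its restrictions to the
  supports. Nothing is left over, as \<open>g\<close> moves only points of the supports.
\<close>

lemma stabilizer_set_product:
  assumes "disjoint_supports Xs"
    and X: "\<And>X. X \<in> set Xs \<Longrightarrow> finite X" "\<And>X. X \<in> set Xs \<Longrightarrow> X \<noteq> {}"
      "\<And>X A. X \<in> set Xs \<Longrightarrow> \<not> common_block X A"
  shows "stabilizer (set_product Xs) = set_product (map stabilizer Xs)"
proof
  have ne: "\<forall>X\<in>set Xs. X \<noteq> {}" using X(2) by blast
  note supp = supp_set_product[OF assms(1) ne]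
  show "stabilizer (set_product Xs) \<subseteq> set_product (map stabilizer Xs)"
  proof
    fix g assume g: "g \<in> stabilizer (set_product Xs)"
    have comm: "g \<langle>$\<rangle> (x \<langle>$\<rangle> p) = x \<langle>$\<rangle> (g \<langle>$\<rangle> p)" if "x \<in> set_product Xs" for x p
      using g that unfolding mem_stabilizer_iff by blast
    have pres: "(\<langle>$\<rangle>) g ` supp (Xs ! i) = supp (Xs ! i)" if i: "i < length Xs" for i
    proof (rule perm_image_eq_if_subset)
      show "finite (supp (Xs ! i))"
        using X(1)[of "Xs ! i"] i by (simp add: supp_def)
      show "(\<langle>$\<rangle>) g ` supp (Xs ! i) \<subseteq> supp (Xs ! i)"
        using commuting_preserves_supports[OF assms(1) ne comm i X(3)[OF nth_mem[OF i]]]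
        by (rule image_subsetI)
    qed
    define gs where "gs = map (\<lambda>X. restrict_perm (supp X) g) Xs"
    have gs_nth: "gs ! i = restrict_perm (supp (Xs ! i)) g" if "i < length Xs" for i
      using that by (simp add: gs_def)
    have gs_aff: "list_all2 (\<lambda>x X. affected x \<subseteq> supp X) gs Xs"
      using pres by (simp add: gs_def list_all2_conv_all_nth affected_restrict_perm)
    obtain zs where zs: "\<And>i x. i < length Xs \<Longrightarrow> x \<in> Xs ! i \<Longrightarrow> zs[i := x] \<in> listset Xs"
      "zs \<in> listset Xs"
      using listset_through[OF ne] by blast
    have len: "length zs = length Xs"
      using zs(2) by (simp add: mem_listset_iff list_all2_lengthD)
    have "restrict_perm (supp (Xs ! i)) g \<in> stabilizer (Xs ! i)" if i: "i < length Xs" for i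
    proof -
      let ?B = "supp (Xs ! i)"
      have "restrict_perm ?B g \<langle>$\<rangle> (x \<langle>$\<rangle> p) = x \<langle>$\<rangle> (restrict_perm ?B g \<langle>$\<rangle> p)"
        if x: "x \<in> Xs ! i" for x p
      proof (cases "p \<in> ?B")
        case True
        let ?P = "prod_list (zs[i := x])"
        have P: "?P \<langle>$\<rangle> r = x \<langle>$\<rangle> r" if "r \<in> ?B" for r
          using listset_block_action[OF listset_affected[OF zs(1)[OF i x]] assms(1) i that] i len
          by simp
        have "g \<langle>$\<rangle> (?P \<langle>$\<rangle> p) = ?P \<langle>$\<rangle> (g \<langle>$\<rangle> p)"
          by (rule comm) (simp add: set_product_def zs(1)[OF i x])
        moreover have "g \<langle>$\<rangle> p \<in> ?B" using True pres[OF i] by blast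
        moreover have "x \<langle>$\<rangle> p \<in> ?B"
          using True apply_in_iff_of_affected_subset[OF affected_subset_supp[OF x]] by simp
        ultimately show ?thesis
          using True P by (simp add: apply_restrict_perm[OF pres[OF i]])
      next
        case False
        moreover have "x \<langle>$\<rangle> p = p"
          using False x by (auto simp: supp_def in_affected)
        ultimately show ?thesis
          by (simp add: apply_restrict_perm[OF pres[OF i]])
      qed
      then show ?thesis
        unfolding mem_stabilizer_iff affected_restrict_perm[OF pres[OF i]] by blast
    qed
    then have "gs \<in> listset (map stabilizer Xs)"
      by (simp add: gs_def mem_listset_iff list_all2_conv_all_nth)
    moreover have "prod_list gs = g"
    proof (rule perm_eqI)
      fix p
      show "prod_list gs \<langle>$\<rangle> p = g \<langle>$\<rangle> p"
      proof (cases "\<exists>i<length Xs. p \<in> supp (Xs ! i)")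
        case True
        then obtain i where i: "i < length Xs" "p \<in> supp (Xs ! i)" by blast
        then show ?thesis
          using listset_block_action[OF gs_aff assms(1) i]
          by (simp add: gs_nth apply_restrict_perm[OF pres])
      next
        case False
        then have out: "\<forall>X\<in>set Xs. p \<notin> supp X"
          by (auto simp: in_set_conv_nth)
        then have "p \<notin> affected g"
          using g unfolding mem_stabilizer_iff supp by blast
        then show ?thesis
          using listset_outside_action[OF gs_aff out] by (simp add: in_affected)
      qed
    qed
    ultimately show "g \<in> set_product (map stabilizer Xs)"
      unfolding set_product_def by blast
  qed
  show "set_product (map stabilizer Xs) \<subseteq> stabilizer (set_product Xs)"
  proof
    fix g assume "g \<in> set_product (map stabilizer Xs)"
    then obtain gs where gs: "gs \<in> listset (map stabilizer Xs)" "g = prod_list gs"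
      by (auto simp: set_product_def)
    then have len: "length gs = length Xs"
      by (simp add: mem_listset_iff list_all2_conv_all_nth)
    have gs_nth: "gs ! i \<in> stabilizer (Xs ! i)" if "i < length Xs" for i
      using list_all2_nthD2[OF gs(1)[unfolded mem_listset_iff], of i] that by simp
    have gs_aff: "list_all2 (\<lambda>x X. affected x \<subseteq> supp X) gs Xs"
      unfolding list_all2_conv_all_nth using len gs_nth affected_subset_supp_if_stabilizer by simp
    have "g \<langle>$\<rangle> (prod_list xs \<langle>$\<rangle> p) = prod_list xs \<langle>$\<rangle> (g \<langle>$\<rangle> p)" if xs: "xs \<in> listset Xs" for xs p
    proof (cases "\<exists>i<length Xs. p \<in> supp (Xs ! i)")
      case True
      then obtain i where i: "i < length Xs" "p \<in> supp (Xs ! i)" by blast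
      have xi: "xs ! i \<in> Xs ! i"
        using xs i(1) by (simp add: mem_listset_iff list_all2_conv_all_nth)
      have "(xs ! i) \<langle>$\<rangle> p \<in> supp (Xs ! i)" "(gs ! i) \<langle>$\<rangle> p \<in> supp (Xs ! i)"
        using i(2) gs_aff i(1) affected_subset_supp[OF xi]
        by (simp_all add: apply_in_iff_of_affected_subset list_all2_conv_all_nth)
      moreover have "(gs ! i) \<langle>$\<rangle> ((xs ! i) \<langle>$\<rangle> p) = (xs ! i) \<langle>$\<rangle> ((gs ! i) \<langle>$\<rangle> p)"
        using gs_nth[OF i(1)] xi unfolding mem_stabilizer_iff by blast
      ultimately show ?thesis
        unfolding gs(2) using i(2)
        by (simp only: listset_block_action[OF gs_aff assms(1) i(1)]
            listset_block_action[OF listset_affected[OF xs] assms(1) i(1)])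
    next
      case False
      then have "\<forall>X\<in>set Xs. p \<notin> supp X"
        by (auto simp: in_set_conv_nth)
      then show ?thesis
        unfolding gs(2)
        by (simp only: listset_outside_action[OF gs_aff] listset_outside_action[OF listset_affected[OF xs]])
    qed
    then have "\<forall>x\<in>set_product Xs. \<forall>p. g \<langle>$\<rangle> (x \<langle>$\<rangle> p) = x \<langle>$\<rangle> (g \<langle>$\<rangle> p)"
      unfolding set_product_def by (intro ballI allI) (elim imageE, simp only:)
    moreover have "affected g \<subseteq> supp (set_product Xs)"
    proof
      fix p assume "p \<in> affected g"
      then have "\<not> (\<forall>X\<in>set Xs. p \<notin> supp X)"
        using listset_outside_action[OF gs_aff] unfolding gs(2) in_affected by (rule contrapos_nn)
      then show "p \<in> supp (set_product Xs)"
        unfolding supp by simp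
    qed
    ultimately show "g \<in> stabilizer (set_product Xs)"
      unfolding mem_stabilizer_iff by blast
  qed
qed

theorem lemma4p6:
  fixes q s :: nat and Y :: "nat perm set" and Ys :: "nat perm set list"
  assumes "q \<ge> 2"
    and "irreducible_set q Y"
    and "card Y > 1"
    and "s \<ge> 1"
    and "length Ys = s"
    and "\<forall>Y'\<in>set Ys. equivalent Y' Y"
    and "disjoint_supports Ys"
  shows "stabilizer (set_product Ys) = set_product (map stabilizer Ys)
    \<and> stabilizer (set_product Ys) \<in> star_power s (stabilizer Y)"
proof
  have Y: "finite Y" "Y \<noteq> {}"
    using assms(2) by (auto simp: irreducible_set_def cycle_sets_def)
  have conj: "\<exists>f. bij f \<and> Y = conj_perm f ` Y'" if "Y' \<in> set Ys" for Y'
    using assms(6) that by (simp add: equivalent_iff_conj_perm)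
  show eq: "stabilizer (set_product Ys) = set_product (map stabilizer Ys)"
  proof (rule stabilizer_set_product[OF assms(7)])
    fix Y' assume "Y' \<in> set Ys"
    from conj[OF this] obtain f where f: "bij f" "Y = conj_perm f ` Y'"
      by (elim exE conjE)
    have "inj_on (conj_perm f) Y'"
      by (rule inj_on_inverseI[of _ "conj_perm (inv f)"]) (rule conj_perm_inv(1)[OF f(1)])
    then show "finite Y'" using Y(1) f(2) by (simp add: finite_image_iff)
    show "Y' \<noteq> {}" using Y(2) f(2) by blast
    show "\<not> common_block Y' A" for A
      using common_block_conj[OF f(1), of Y' A] irreducible_no_common_block[OF assms(2,3)]
      unfolding f(2)[symmetric] by blast
  qed
  have "equivalent Z (stabilizer Y)" if Z: "Z \<in> set (map stabilizer Ys)" for Z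
  proof -
    obtain Y' where Y': "Y' \<in> set Ys" "Z = stabilizer Y'"
      using Z by auto
    obtain f where f: "bij f" "Y = conj_perm f ` Y'"
      using conj[OF Y'(1)] by (elim exE conjE)
    have "stabilizer Y = conj_perm f ` Z"
      unfolding f(2) Y'(2) by (rule stabilizer_conj[OF f(1)])
    then show ?thesis
      unfolding equivalent_iff_conj_perm using f(1) by (intro exI[of _ f] conjI)
  qed
  moreover have supp_stabilizer: "supp (stabilizer X) \<subseteq> supp X" for X
    unfolding supp_def[of "stabilizer X"] using affected_subset_supp_if_stabilizer by blast
  have "disjoint_supports (map stabilizer Ys)"
    unfolding disjoint_supports_def sorted_wrt_map
  proof (rule sorted_wrt_mono_rel[OF _ assms(7)[unfolded disjoint_supports_def]])
    fix X Z assume "supp X \<inter> supp Z = {}"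
    then show "supp (stabilizer X) \<inter> supp (stabilizer Z) = {}"
      using supp_stabilizer[of X] supp_stabilizer[of Z] by blast
  qed
  ultimately show "stabilizer (set_product Ys) \<in> star_power s (stabilizer Y)"
    unfolding eq star_power_def using assms(5)
    by (intro CollectI exI[of _ "map stabilizer Ys"] conjI ballI refl) simp_all
qed

end
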